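(* Let $\gamma>-1$, $0<\lambda\le\Lambda$, let $\Omega,F,\mathfrak b,\lambda_0$ be as in the context, and let $u$ be a nonnegative, bounded viscosity solution of $$F(x,Du,D^2u)+|Du|^{\gamma}\langle \mathfrak b(x),Du\rangle=\lambda_0(x)\,u^{\gamma+1}\chi_{\{u>0\}}(x)\quad\text{in } \Omega .$$ Then either $u>0$ in $\Omega$ or $u\equiv0$ in $\Omega$.
   Context: $B_r(x)$ is the open ball of radius $r$ centred at $x$ in $\mathbb{R}^N$; $\mathrm{Sym}(N)$ is the space of real symmetric $N\times N$ matrices. Data: $\Omega\subset\mathbb{R}^N$ is a smooth bounded domain; $\mathfrak b\in C^0(\overline\Omega,\mathbb{R}^N)$; $\lambda_0\in C^0(\overline\Omega)$ is bounded away from zero and infinity ($0<\inf\lambda_0\le\sup\lambda_0<\infty$); $F:\Omega\times(\mathbb{R}^N\setminus\{0\})\times \mathrm{Sym}(N)\to\mathbb{R}$ is continuous and satisfies: (F1) for all $x\in\Omega$, $p\in\mathbb{R}^N\setminus\{0\}$, $M,P\in \mathrm{Sym}(N)$ with $P\ge0$: $|p|^\gamma\mathcal P^-_{\lambda,\Lambda}(P)\le F(x,p,M+P)-F(x,p,M)\le|p|^\gamma\mathcal P^+_{\lambda,\Lambda}(P)$, where, with $e_i$ the eigenvalues of $M$, $\mathcal P^+_{\lambda,\Lambda}(M)=\lambda\sum_{e_i<0}e_i+\Lambda\sum_{e_i>0}e_i$ and $\mathcal P^-_{\lambda,\Lambda}(M)=\lambda\sum_{e_i>0}e_i+\Lambda\sum_{e_i<0}e_i$;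 (F2) $F(x,sp,M)=|s|^\gamma F(x,p,M)$ for all $s\in\mathbb{R}\setminus\{0\}$, $x\in\Omega$, $p\in\mathbb{R}^N\setminus\{0\}$, $M\in \mathrm{Sym}(N)$. Write $G(x,p,M)=F(x,p,M)+|p|^\gamma\langle\mathfrak b(x),p\rangle$. Viscosity solutions: $u\in C^0(\Omega)$ is a viscosity super-solution (resp. sub-solution) of $G(x,Du,D^2u)=f(x,u)$ in $\Omega$ if for each $x_0\in\Omega$: if $u$ is constant, $u=K$, on some ball $B_\varepsilon(x_0)\subset\Omega$, then $f(x,K)\ge0$ (resp. $\le0$) for all $x\in B_\varepsilon(x_0)$; otherwise, for every $\phi\in C^2(\Omega)$ such that $u-\phi$ has a local minimum (resp. maximum) at $x_0$ and $D\phi(x_0)\ne0$, $G(x_0,D\phi(x_0),D^2\phi(x_0))\le f(x_0,u(x_0))$ (resp. $\ge$). A viscosity solution is both. Here $f(x,u)=\lambda_0(x)u^{\gamma+1}\chi_{\{u>0\}}$.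
   Formalization: The formal theorem additionally assumes F(x,p,0)=0 for all x in Ω, p≠0; without it the claim fails, e.g. N=1, Ω=(-1,1), γ=0, λ=Λ=1, b=0, λ_0=1, F=M-2+x^2, u=x^2. *)

theory Defs
  imports "HOL-Analysis.Analysis"
begin

section \<open>Functions of class \<open>C\<^sup>k\<close> and smooth domains\<close>

text \<open>
  \<open>Ck_on k f S\<close> is meant for open \<open>S\<close>: all iterated directional derivatives of \<open>f\<close> of order
  at most \<open>k\<close> exist and are continuous on \<open>S\<close>.
\<close>

fun Ck_on :: "nat \<Rightarrow> ('a::euclidean_space \<Rightarrow> real) \<Rightarrow> 'a set \<Rightarrow> bool" where
  "Ck_on 0 f S \<longleftrightarrow> continuous_on S f"
| "Ck_on (Suc k) f S \<longleftrightarrow>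
     (\<forall>x\<in>S. f differentiable (at x)) \<and>
     (\<forall>v. Ck_on k (\<lambda>x. frechet_derivative f (at x) v) S)"

definition grad :: "(real^'n \<Rightarrow> real) \<Rightarrow> real^'n \<Rightarrow> real^'n" where
  "grad f x = (\<chi> i. frechet_derivative f (at x) (axis i 1))"

definition hessian :: "(real^'n \<Rightarrow> real) \<Rightarrow> real^'n \<Rightarrow> real^'n^'n" where
  "hessian f x = jacobian (grad f) (at x)"

text \<open>
  Near each boundary point the domain is, in direction \<open>e\<close>, the strict epigraph of a smooth
  function of the variables orthogonal to \<open>e\<close>.  Such a function is represented by a smooth \<open>g\<close> on
  the whole space that does not change along \<open>e\<close>.
\<close>

definition smooth_boundary :: "'a::euclidean_space set \<Rightarrow> bool" where
  "smooth_boundary \<Omega> \<longleftrightarrow>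
     (\<forall>x\<in>frontier \<Omega>. \<exists>r>0. \<exists>e g. norm e = 1 \<and> (\<forall>k. Ck_on k g UNIV) \<and>
        (\<forall>y t. g (y + t *\<^sub>R e) = g y) \<and>
        \<Omega> \<inter> ball x r = {y \<in> ball x r. g y < y \<bullet> e})"

definition smooth_bounded_domain :: "'a::euclidean_space set \<Rightarrow> bool" where
  "smooth_bounded_domain \<Omega> \<longleftrightarrow>
     open \<Omega> \<and> connected \<Omega> \<and> \<Omega> \<noteq> {} \<and> bounded \<Omega> \<and> smooth_boundary \<Omega>"

section \<open>Symmetric matrices and the Pucci extremal operators\<close>

definition Sym :: "(real^'n^'n) set" where
  "Sym = {M. transpose M = M}"

definition pos_semidef :: "real^'n^'n \<Rightarrow> bool" where
  "pos_semidef P \<longleftrightarrow> (\<forall>v. 0 \<le> v \<bullet> (P *v v))"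

definition eigenspace :: "real^'n^'n \<Rightarrow> real \<Rightarrow> (real^'n) set" where
  "eigenspace M e = {v. M *v v = e *\<^sub>R v}"

definition eigenvalues :: "real^'n^'n \<Rightarrow> real set" where
  "eigenvalues M = {e. \<exists>v. v \<noteq> 0 \<and> v \<in> eigenspace M e}"

text \<open>
  Eigenvalues are counted with multiplicity.  For symmetric matrices, the only ones to which the
  operators below are applied, the multiplicity is the dimension of the eigenspace; the
  sums are then over finite sets, by \<open>finite_eigenvalues\<close>.
\<close>

definition pucci_plus :: "real \<Rightarrow> real \<Rightarrow> real^'n^'n \<Rightarrow> real" where
  "pucci_plus lam Lam M =
     lam * (\<Sum>e\<in>{e \<in> eigenvalues M. e < 0}. real (dim (eigenspace M e)) * e) +
     Lam * (\<Sum>e\<in>{e \<in> eigenvalues M. e > 0}. real (dim (eigenspace M e)) * e)"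

definition pucci_minus :: "real \<Rightarrow> real \<Rightarrow> real^'n^'n \<Rightarrow> real" where
  "pucci_minus lam Lam M =
     lam * (\<Sum>e\<in>{e \<in> eigenvalues M. e > 0}. real (dim (eigenspace M e)) * e) +
     Lam * (\<Sum>e\<in>{e \<in> eigenvalues M. e < 0}. real (dim (eigenspace M e)) * e)"

lemma finite_eigenvalues:
  assumes "M \<in> Sym"
  shows "finite (eigenvalues M)"
proof -
  define w where "w e = (SOME v. v \<noteq> 0 \<and> v \<in> eigenspace M e)" for e
  have w: "w e \<noteq> 0 \<and> M *v w e = e *\<^sub>R w e" if "e \<in> eigenvalues M" for e
  proof -
    have "\<exists>v. v \<noteq> 0 \<and> v \<in> eigenspace M e" using that by (simp add: eigenvalues_def)
    then have "w e \<noteq> 0 \<and> w e \<in> eigenspace M e" unfolding w_def by (rule someI_ex)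
    then show ?thesis by (simp add: eigenspace_def)
  qed
  have sym: "(M *v x) \<bullet> y = x \<bullet> (M *v y)" for x y
  proof -
    have "M *v x = x v* M"
      using assms transpose_matrix_vector[of M x] by (simp add: Sym_def)
    then show ?thesis by (simp add: dot_lmul_matrix)
  qed
  have orth: "w a \<bullet> w b = 0" if "a \<in> eigenvalues M" "b \<in> eigenvalues M" "a \<noteq> b" for a b
  proof -
    have "a * (w a \<bullet> w b) = b * (w a \<bullet> w b)"
      using sym[of "w a" "w b"] w[OF that(1)] w[OF that(2)] by simp
    then show ?thesis using that(3) by simp
  qed
  have inj: "inj_on w (eigenvalues M)"
  proof (rule inj_onI, rule ccontr)
    fix a b assume ab: "a \<in> eigenvalues M" "b \<in> eigenvalues M" "w a = w b" "a \<noteq> b"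
    then have "w b \<bullet> w b = 0" using orth[of a b] by simp
    then show False using w[of b] ab(2) by simp
  qed
  have "pairwise orthogonal (w ` eigenvalues M)"
    unfolding pairwise_def orthogonal_def using orth by blast
  moreover have "0 \<notin> w ` eigenvalues M" using w by (metis imageE)
  ultimately have "independent (w ` eigenvalues M)"
    by (rule pairwise_orthogonal_independent)
  then have "finite (w ` eigenvalues M)" by (rule independent_imp_finite)
  with inj show ?thesis by (rule finite_imageD[rotated])
qed

section \<open>Viscosity solutions\<close>

definition const_near :: "'a::metric_space set \<Rightarrow> ('a \<Rightarrow> real) \<Rightarrow> 'a \<Rightarrow> real \<Rightarrow> real \<Rightarrow> bool" where
  "const_near \<Omega> u x \<epsilon> K \<longleftrightarrow> \<epsilon> > 0 \<and> ball x \<epsilon> \<subseteq> \<Omega> \<and> (\<forall>y\<in>ball x \<epsilon>. u y = K)"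

definition local_min_at :: "'a::metric_space set \<Rightarrow> ('a \<Rightarrow> real) \<Rightarrow> 'a \<Rightarrow> bool" where
  "local_min_at \<Omega> h x \<longleftrightarrow> (\<exists>r>0. \<forall>y\<in>\<Omega> \<inter> ball x r. h x \<le> h y)"

definition local_max_at :: "'a::metric_space set \<Rightarrow> ('a \<Rightarrow> real) \<Rightarrow> 'a \<Rightarrow> bool" where
  "local_max_at \<Omega> h x \<longleftrightarrow> (\<exists>r>0. \<forall>y\<in>\<Omega> \<inter> ball x r. h y \<le> h x)"

text \<open>
  \<open>G\<close> need only be meaningful for nonzero gradients, so points near which \<open>u\<close> is constant are
  treated separately.
\<close>

definition viscosity_supersolution ::
  "(real^'n) set \<Rightarrow> (real^'n \<Rightarrow> real^'n \<Rightarrow> real^'n^'n \<Rightarrow> real) \<Rightarrow> (real^'n \<Rightarrow> real \<Rightarrow> real) \<Rightarrow>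
   (real^'n \<Rightarrow> real) \<Rightarrow> bool" where
  "viscosity_supersolution \<Omega> G f u \<longleftrightarrow> continuous_on \<Omega> u \<and>
     (\<forall>x0\<in>\<Omega>.
        (\<forall>\<epsilon> K. const_near \<Omega> u x0 \<epsilon> K \<longrightarrow> (\<forall>x\<in>ball x0 \<epsilon>. f x K \<ge> 0)) \<and>
        ((\<nexists>\<epsilon> K. const_near \<Omega> u x0 \<epsilon> K) \<longrightarrow>
           (\<forall>\<phi>. Ck_on 2 \<phi> \<Omega> \<longrightarrow> local_min_at \<Omega> (\<lambda>x. u x - \<phi> x) x0 \<longrightarrow> grad \<phi> x0 \<noteq> 0 \<longrightarrow>
              G x0 (grad \<phi> x0) (hessian \<phi> x0) \<le> f x0 (u x0))))"

definition viscosity_subsolution ::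
  "(real^'n) set \<Rightarrow> (real^'n \<Rightarrow> real^'n \<Rightarrow> real^'n^'n \<Rightarrow> real) \<Rightarrow> (real^'n \<Rightarrow> real \<Rightarrow> real) \<Rightarrow>
   (real^'n \<Rightarrow> real) \<Rightarrow> bool" where
  "viscosity_subsolution \<Omega> G f u \<longleftrightarrow> continuous_on \<Omega> u \<and>
     (\<forall>x0\<in>\<Omega>.
        (\<forall>\<epsilon> K. const_near \<Omega> u x0 \<epsilon> K \<longrightarrow> (\<forall>x\<in>ball x0 \<epsilon>. f x K \<le> 0)) \<and>
        ((\<nexists>\<epsilon> K. const_near \<Omega> u x0 \<epsilon> K) \<longrightarrow>
           (\<forall>\<phi>. Ck_on 2 \<phi> \<Omega> \<longrightarrow> local_max_at \<Omega> (\<lambda>x. u x - \<phi> x) x0 \<longrightarrow> grad \<phi> x0 \<noteq> 0 \<longrightarrow>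
              G x0 (grad \<phi> x0) (hessian \<phi> x0) \<ge> f x0 (u x0))))"

definition viscosity_solution ::
  "(real^'n) set \<Rightarrow> (real^'n \<Rightarrow> real^'n \<Rightarrow> real^'n^'n \<Rightarrow> real) \<Rightarrow> (real^'n \<Rightarrow> real \<Rightarrow> real) \<Rightarrow>
   (real^'n \<Rightarrow> real) \<Rightarrow> bool" where
  "viscosity_solution \<Omega> G f u \<longleftrightarrow>
     viscosity_supersolution \<Omega> G f u \<and> viscosity_subsolution \<Omega> G f u"

end

theory Submission
  imports Defs
begin

text \<open>
  If \<open>u\<close> vanishes somewhere but not everywhere, some ball \<open>B\<^sub>R(y)\<close> on which \<open>u > 0\<close> touches the zero
  set at a point \<open>z\<close>.  The Hopf barrier \<open>\<phi> x = c (exp (-a \<bar>x - y\<bar>\<^sup>2) - exp (-a R\<^sup>2))\<close> is, for \<open>a\<close>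
  large and independently of \<open>c > 0\<close>, a strict classical subsolution for \<open>R/2 \<le> \<bar>x - y\<bar> \<le> R\<close>,
  because the bound from (F1) and the right-hand side both scale like \<open>c\<close> to the power \<open>\<gamma> + 1\<close>.
  For small \<open>c\<close> the minimum of \<open>u - \<phi>\<close> over \<open>R/2 \<le> \<bar>x - y\<bar> \<le> 2R\<close> is at most \<open>0\<close> because of \<open>z\<close>,
  so it is attained at an interior point, where \<open>u \<le> \<phi>\<close> contradicts the supersolution property.
\<close>

section \<open>Pucci operators of scalar and rank-one matrices\<close>

definition outer :: "real \<Rightarrow> real^'n \<Rightarrow> real^'n^'n" where
  "outer k v = (\<chi> i j. k * (v$i * v$j))"

lemma outer_mult_vec: "outer k v *v w = (k * (v \<bullet> w)) *\<^sub>R v"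
  by (simp add: outer_def matrix_vector_mult_def vec_eq_iff inner_vec_def sum_distrib_left
      sum_distrib_right mult_ac)

lemma mat_mult_vec: "mat k *v w = k *\<^sub>R (w::real^'n)"
  by (simp add: mat_def matrix_vector_mult_def vec_eq_iff if_distrib if_distribR cong: if_cong)

lemma outer_Sym: "outer k v \<in> Sym"
  by (simp add: Sym_def outer_def transpose_def vec_eq_iff mult_ac)

lemma mat_Sym: "mat k \<in> Sym"
  by (simp add: Sym_def)

lemma pos_semidef_outer: "0 \<le> k \<Longrightarrow> pos_semidef (outer k v)"
  by (simp add: pos_semidef_def outer_mult_vec inner_commute mult.assoc)

lemma pos_semidef_mat: "0 \<le> k \<Longrightarrow> pos_semidef (mat k)"
  by (simp add: pos_semidef_def mat_mult_vec)

text \<open>The range of \<open>outer k v\<close> is the line through \<open>v\<close>, so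
  \<open>k * (v \<bullet> v)\<close> is the only nonzero eigenvalue and it is simple; the kernel
  contributes nothing to the sum.\<close>

lemma pucci_minus_outer:
  fixes v :: "real^'n"
  assumes "0 < k" "v \<noteq> 0"
  shows "pucci_minus lam Lam (outer k v) = lam * k * (v \<bullet> v)"
proof -
  have vv: "0 < k * (v \<bullet> v)" using assms by simp
  have eig: "e = k * (v \<bullet> v)" if "e \<in> eigenvalues (outer k v)" "e \<noteq> 0" for e
  proof -
    from that obtain w where w: "w \<noteq> 0" "(k * (v \<bullet> w)) *\<^sub>R v = e *\<^sub>R w"
      by (auto simp: eigenvalues_def eigenspace_def outer_mult_vec)
    then have "v \<bullet> w \<noteq> 0" using that by auto
    \<comment> \<open>Pairing the eigenvector equation with \<open>v\<close> allows cancelling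
      \<open>v \<bullet> w\<close>, which is nonzero because otherwise \<open>e *\<^sub>R w\<close>
      would vanish.\<close>
    moreover have "v \<bullet> ((k * (v \<bullet> w)) *\<^sub>R v) = v \<bullet> (e *\<^sub>R w)" using w by simp
    ultimately show ?thesis by (simp add: algebra_simps)
  qed
  have "v \<in> eigenspace (outer k v) (k * (v \<bullet> v))"
    by (simp add: eigenspace_def outer_mult_vec)
  then have mem: "k * (v \<bullet> v) \<in> eigenvalues (outer k v)"
    using assms by (auto simp: eigenvalues_def)
  have pos: "{e \<in> eigenvalues (outer k v). e > 0} = {k * (v \<bullet> v)}"
    using eig mem vv by auto
  have neg: "{e \<in> eigenvalues (outer k v). e < 0} = {}"
    using eig vv by fastforce
  have "eigenspace (outer k v) (k * (v \<bullet> v)) = span {v}"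
  proof (intro equalityI subsetI)
    fix w assume "w \<in> eigenspace (outer k v) (k * (v \<bullet> v))"
    then have "(v \<bullet> w) *\<^sub>R v = (v \<bullet> v) *\<^sub>R w"
      using assms by (simp add: eigenspace_def outer_mult_vec flip: scaleR_scaleR)
    then have "inverse (v \<bullet> v) *\<^sub>R ((v \<bullet> w) *\<^sub>R v) = w"
      using assms by simp
    then have "w = (inverse (v \<bullet> v) * (v \<bullet> w)) *\<^sub>R v" by simp
    then show "w \<in> span {v}" by (metis span_base span_scale singletonI)
  next
    fix w assume "w \<in> span {v}"
    then show "w \<in> eigenspace (outer k v) (k * (v \<bullet> v))"
      by (auto simp: span_singleton eigenspace_def outer_mult_vec mult_ac)
  qed
  then have "dim (eigenspace (outer k v) (k * (v \<bullet> v))) = 1"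
    using assms by (simp add: dim_span_eq_card_independent)
  then show ?thesis by (simp add: pucci_minus_def pos neg)
qed

lemma pucci_plus_mat:
  assumes "0 < k"
  shows "pucci_plus lam Lam (mat k :: real^'n^'n) = Lam * CARD('n) * k"
proof -
  have E: "eigenspace (mat k :: real^'n^'n) k = UNIV"
    by (simp add: eigenspace_def mat_mult_vec)
  have "\<exists>v::real^'n. v \<noteq> 0" by (rule exI[of _ "axis undefined 1"]) simp
  then have "eigenvalues (mat k :: real^'n^'n) = {k}"
    by (auto simp: eigenvalues_def eigenspace_def mat_mult_vec)
  then have pos: "{e \<in> eigenvalues (mat k :: real^'n^'n). e > 0} = {k}"
    and neg: "{e \<in> eigenvalues (mat k :: real^'n^'n). e < 0} = {}"
    using assms by auto
  show ?thesis by (simp add: pucci_plus_def pos neg E dim_UNIV)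
qed

section \<open>The Hopf barrier\<close>

text \<open>With \<open>d\<close> as a parameter, \<open>hopf a c 0 y\<close> is the bare
  exponential, in which all derivatives are expressed whatever the shift is.\<close>

definition hopf :: "real \<Rightarrow> real \<Rightarrow> real \<Rightarrow> 'a::euclidean_space \<Rightarrow> 'a \<Rightarrow> real" where
  "hopf a c d y x = c * exp (- a * ((x - y) \<bullet> (x - y))) - d"

lemma hopf_has_derivative:
  "(hopf a c d y has_derivative (\<lambda>h. - 2 * a * hopf a c 0 y x * ((x - y) \<bullet> h))) (at x)"
  unfolding hopf_def
  by (auto intro!: derivative_eq_intros ext simp: inner_commute algebra_simps)

lemma hopf_frechet:
  "frechet_derivative (hopf a c d y) (at x) = (\<lambda>h. - 2 * a * hopf a c 0 y x * ((x - y) \<bullet> h))"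
  by (rule frechet_derivative_at[OF hopf_has_derivative, symmetric])

lemma hopf_directional_has_derivative:
  "((\<lambda>x. - 2 * a * hopf a c 0 y x * ((x - y) \<bullet> v)) has_derivative
    (\<lambda>h. hopf a c 0 y x * (4 * a\<^sup>2 * ((x - y) \<bullet> h) * ((x - y) \<bullet> v) - 2 * a * (h \<bullet> v)))) (at x)"
  by (auto intro!: derivative_eq_intros hopf_has_derivative ext
      simp: algebra_simps power2_eq_square)

lemma continuous_on_hopf: "continuous_on S (hopf a c d y)"
  unfolding hopf_def by (intro continuous_intros)

lemma Ck_on_hopf: "Ck_on 2 (hopf a c d y) S"
proof -
  have D2: "frechet_derivative (\<lambda>x. - 2 * a * hopf a c 0 y x * ((x - y) \<bullet> v)) (at x) =
      (\<lambda>h. hopf a c 0 y x * (4 * a\<^sup>2 * ((x - y) \<bullet> h) * ((x - y) \<bullet> v) - 2 * a * (h \<bullet> v)))" for x v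
    by (rule frechet_derivative_at[OF hopf_directional_has_derivative, symmetric])
  have diff: "(\<lambda>x. - 2 * a * hopf a c 0 y x * ((x - y) \<bullet> v)) differentiable (at x)" for x v
    using hopf_directional_has_derivative differentiableI by blast
  have "hopf a c d y differentiable (at x)" for x
    using hopf_has_derivative differentiableI by blast
  moreover have "Ck_on (Suc 0) (\<lambda>x. - 2 * a * hopf a c 0 y x * ((x - y) \<bullet> v)) S" for v
    unfolding Ck_on.simps D2 using diff
    by (auto intro!: continuous_intros continuous_on_hopf)
  ultimately show ?thesis by (simp only: numeral_2_eq_2 Ck_on.simps(2) hopf_frechet) blast
qed

lemma grad_hopf: "grad (hopf a c d y) x = (- 2 * a * hopf a c 0 y x) *\<^sub>R (x - y)"
  by (simp add: grad_def hopf_frechet vec_eq_iff inner_axis)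

lemma hessian_hopf:
  fixes x y :: "real^'n"
  shows
  "hessian (hopf a c d y) x =
    mat (- (2 * a * hopf a c 0 y x)) + outer (4 * a\<^sup>2 * hopf a c 0 y x) (x - y)"
proof -
  let ?D = "\<lambda>h. (- 2 * a * hopf a c 0 y x) *\<^sub>R h +
    (4 * a\<^sup>2 * hopf a c 0 y x * ((x - y) \<bullet> h)) *\<^sub>R (x - y)"
  have eq: "grad (hopf a c d y) = (\<lambda>x. (- 2 * a * hopf a c 0 y x) *\<^sub>R (x - y))"
    by (simp add: grad_hopf fun_eq_iff)
  have "(grad (hopf a c d y) has_derivative ?D) (at x)"
    unfolding eq
    by (auto intro!: derivative_eq_intros hopf_has_derivative ext
        simp: algebra_simps power2_eq_square)
  then have "frechet_derivative (grad (hopf a c d y)) (at x) = ?D"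
    by (rule frechet_derivative_at[symmetric])
  moreover have "axis j (1::real) $ i = (if i = j then 1 else 0)" for i j :: 'n
    by (simp add: axis_def)
  ultimately show ?thesis
    by (simp add: hessian_def jacobian_def matrix_def mat_def outer_def vec_eq_iff inner_axis)
qed

text \<open>Let E be the bare exponential and s = 2a|v|, so that |p| = E s. Apart from the common
  factor |p|^\<gamma> E, the rank-one part of the Hessian contributes at least lam s^2, while the
  scalar part and the drift cost only terms linear in s. The quadratic term wins for large
  \<open>a\<close>, and the powers of E match those on the left. The point is frozen:
  \<open>F\<close> and \<open>B\<close> are the coefficients at \<open>x\<close>.\<close>

lemma hopf_strict_subsolution:
  fixes F :: "real^'n \<Rightarrow> real^'n^'n \<Rightarrow> real" and x y B :: "real^'n" and a c d :: real
  defines "v \<equiv> x - y" and "p \<equiv> grad (hopf a c d y) x"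
  assumes "- 1 < \<gamma>" and "0 < a" "0 < c" "0 < r" "0 \<le> Lam" "r \<le> norm v"
    and F1: "\<And>M P. M \<in> Sym \<Longrightarrow> P \<in> Sym \<Longrightarrow> pos_semidef P \<Longrightarrow>
        norm p powr \<gamma> * pucci_minus lam Lam P \<le> F p (M + P) - F p M \<and>
        F p (M + P) - F p M \<le> norm p powr \<gamma> * pucci_plus lam Lam P"
    and F0: "F p 0 = 0"
    and B: "norm B \<le> \<beta>" and "0 \<le> K"
    and big: "1 \<le> 2 * a * norm v" "\<beta> + Lam * CARD('n) / r + K < lam * (2 * a * norm v)"
  shows "K * hopf a c 0 y x powr (\<gamma> + 1) <
    F p (hessian (hopf a c d y) x) + norm p powr \<gamma> * (B \<bullet> p)"
proof -
  define E where "E = hopf a c 0 y x"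
  define s where "s = 2 * a * norm v"
  define C where "C = \<beta> + Lam * CARD('n) / r"
  have E: "0 < E" using \<open>0 < c\<close> by (simp add: E_def hopf_def)
  have v: "v \<noteq> 0" "0 < norm v" using \<open>0 < r\<close> \<open>r \<le> norm v\<close> by auto
  have p: "p = (- 2 * a * E) *\<^sub>R v" by (simp add: p_def v_def E_def grad_hopf)
  have np: "norm p = E * s" using E \<open>0 < a\<close> by (simp add: p s_def abs_mult mult_ac)
  have H: "hessian (hopf a c d y) x = mat (- (2 * a * E)) + outer (4 * a\<^sup>2 * E) v"
    by (simp add: hessian_hopf E_def v_def)
  have "norm p powr \<gamma> * pucci_minus lam Lam (outer (4 * a\<^sup>2 * E) v)
      \<le> F p (hessian (hopf a c d y) x) - F p (mat (- (2 * a * E)))"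
    unfolding H using F1[OF mat_Sym outer_Sym pos_semidef_outer] E by simp
  moreover have "pucci_minus lam Lam (outer (4 * a\<^sup>2 * E) v) = E * (lam * s\<^sup>2)"
    using pucci_minus_outer[of "4 * a\<^sup>2 * E" v lam Lam] E v \<open>0 < a\<close>
    by (simp add: s_def power2_norm_eq_inner power_mult_distrib mult_ac)
  \<comment> \<open>(F1) compares only along nonnegative increments, so the negative scalar part is
    reached backwards: adding \<open>mat (2 * a * E)\<close> to it gives 0, where \<open>F0\<close>
    supplies the value.\<close>
  moreover have "mat (- (2 * a * E)) + mat (2 * a * E) = (0 :: real^'n^'n)"
    by (simp add: mat_def vec_eq_iff)
  then have "- F p (mat (- (2 * a * E))) \<le> norm p powr \<gamma> * pucci_plus lam Lam (mat (2 * a * E) :: real^'n^'n)"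
    using F1[OF mat_Sym[of "- (2 * a * E)"] mat_Sym[of "2 * a * E"] pos_semidef_mat] E \<open>0 < a\<close> F0
    by simp
  moreover have "pucci_plus lam Lam (mat (2 * a * E) :: real^'n^'n) = E * (2 * a * (Lam * CARD('n)))"
    using pucci_plus_mat[of "2 * a * E" lam Lam, where 'n='n] E \<open>0 < a\<close> by (simp add: mult_ac)
  ultimately have F: "norm p powr \<gamma> * (E * (lam * s\<^sup>2) - E * (2 * a * (Lam * CARD('n))))
      \<le> F p (hessian (hopf a c d y) x)"
    by (simp add: algebra_simps)
  have "- (B \<bullet> p) \<le> norm B * norm p" using norm_cauchy_schwarz[of B "- p"] by simp
  also have "\<dots> \<le> \<beta> * (E * s)" using B by (simp add: np[symmetric] mult_right_mono)
  finally have "norm p powr \<gamma> * (- (\<beta> * (E * s))) \<le> norm p powr \<gamma> * (B \<bullet> p)"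
    by (intro mult_left_mono) auto
  with F have "norm p powr \<gamma> * (E * (lam * s\<^sup>2 - 2 * a * (Lam * CARD('n)) - \<beta> * s))
      \<le> F p (hessian (hopf a c d y) x) + norm p powr \<gamma> * (B \<bullet> p)"
    by (simp add: algebra_simps)
  moreover have "s * (lam * s - C) \<le> lam * s\<^sup>2 - 2 * a * (Lam * CARD('n)) - \<beta> * s"
  proof -
    \<comment> \<open>Since r \<le> |v|, the factor 2a is at most s/r, which makes the scalar part
      linear in s as well.\<close>
    have "2 * a * r \<le> s" using \<open>0 < a\<close> \<open>r \<le> norm v\<close> by (simp add: s_def)
    then have "(2 * a * r) * (Lam * CARD('n) / r) \<le> s * (Lam * CARD('n) / r)"
      using \<open>0 \<le> Lam\<close> \<open>0 < r\<close> by (intro mult_right_mono) auto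
    then show ?thesis using \<open>0 < r\<close> by (simp add: C_def algebra_simps power2_eq_square)
  qed
  then have "norm p powr \<gamma> * (E * (s * (lam * s - C)))
      \<le> norm p powr \<gamma> * (E * (lam * s\<^sup>2 - 2 * a * (Lam * CARD('n)) - \<beta> * s))"
    using E by (intro mult_left_mono) auto
  moreover have "norm p powr \<gamma> * (E * (s * (lam * s - C))) = (E powr (\<gamma> + 1) * s powr (\<gamma> + 1)) * (lam * s - C)"
    using E big(1) by (simp add: np powr_mult powr_add s_def[symmetric])
  moreover have "K * E powr (\<gamma> + 1) < (E powr (\<gamma> + 1) * s powr (\<gamma> + 1)) * (lam * s - C)"
  proof -
    have K: "K < lam * s - C" using big(2) by (simp add: C_def s_def)
    have "1 \<le> s powr (\<gamma> + 1)" using big(1) \<open>- 1 < \<gamma>\<close> by (simp add: s_def ge_one_powr_ge_zero)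
    then have "1 * (lam * s - C) \<le> s powr (\<gamma> + 1) * (lam * s - C)"
      using K \<open>0 \<le> K\<close> by (intro mult_right_mono) auto
    then have "E powr (\<gamma> + 1) * K < E powr (\<gamma> + 1) * (s powr (\<gamma> + 1) * (lam * s - C))"
      using K E by (intro mult_strict_left_mono) auto
    then show ?thesis by (simp add: mult_ac)
  qed
  ultimately show ?thesis unfolding E_def[symmetric] by linarith
qed

section \<open>A ball touching the zero set\<close>

text \<open>By connectedness the zero set is not open, so some zero \<open>z1\<close> has positive
  points arbitrarily close. From such a point \<open>y\<close>, much closer to \<open>z1\<close>
  than the boundary is, the nearest zero gives the ball; this closeness also keeps the doubled ball
  inside the domain.\<close>

lemma touching_ball:
  fixes u :: "'a::euclidean_space \<Rightarrow> real"
  assumes "open \<Omega>" "connected \<Omega>" "continuous_on \<Omega> u"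
    and nn: "\<And>x. x \<in> \<Omega> \<Longrightarrow> 0 \<le> u x"
    and "\<exists>x\<in>\<Omega>. u x = 0" "\<exists>x\<in>\<Omega>. u x > 0"
  obtains y z R where "0 < R" "cball y (2 * R) \<subseteq> \<Omega>" "dist y z = R" "u z = 0"
    "\<And>x. x \<in> ball y R \<Longrightarrow> 0 < u x"
proof -
  let ?P = "\<Omega> \<inter> u -` {0<..}" and ?Z = "\<Omega> \<inter> u -` {0}"
  have "open ?P"
    by (rule continuous_open_preimage[OF \<open>continuous_on \<Omega> u\<close> \<open>open \<Omega>\<close> open_greaterThan])
  have "\<not> open ?Z"
  proof
    assume "open ?Z"
    moreover have "\<Omega> \<subseteq> ?P \<union> ?Z" using nn by force
    ultimately show False
      using connectedD[OF \<open>connected \<Omega>\<close> \<open>open ?P\<close>] assms(5,6) by fastforce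
  qed
  then obtain z1 where z1: "z1 \<in> ?Z" and nb: "\<And>e. 0 < e \<Longrightarrow> \<not> ball z1 e \<subseteq> ?Z"
    unfolding open_contains_ball by blast
  from z1 \<open>open \<Omega>\<close> obtain e where e: "0 < e" "ball z1 e \<subseteq> \<Omega>"
    unfolding open_contains_ball by blast
  \<comment> \<open>Both dist z1 y and R stay below \<rho>, so the doubled ball lies in the ball of
    radius 3\<rho> about \<open>z1\<close>, strictly inside radius e = 4\<rho>.\<close>
  define \<rho> where "\<rho> = e / 4"
  have \<rho>: "0 < \<rho>" "e = 4 * \<rho>" using e by (auto simp: \<rho>_def)
  obtain y where y: "dist z1 y < \<rho>" "y \<in> \<Omega>" "u y \<noteq> 0"
    using nb[OF \<rho>(1)] e(2) \<rho> by force
  \<comment> \<open>Cutting to a closed ball inside the domain makes the zero set closed. No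
    competitor is lost, since the ball of radius R about \<open>y\<close> lies in this closed
    ball.\<close>
  let ?K = "cball z1 (3 * \<rho>) \<inter> u -` {0}"
  have sub: "cball z1 (3 * \<rho>) \<subseteq> \<Omega>" using e \<rho> by (auto simp: subset_iff)
  have "closed ?K"
    using \<open>continuous_on \<Omega> u\<close> sub by (intro continuous_closed_preimage) (auto intro: continuous_on_subset)
  moreover have z1K: "z1 \<in> ?K" using z1 \<rho> by auto
  ultimately obtain z where z: "z \<in> ?K" "\<And>w. w \<in> ?K \<Longrightarrow> dist y z \<le> dist y w"
    using distance_attains_inf[of ?K y] by blast
  define R where "R = dist y z"
  have R: "R < \<rho>" using z(2)[OF z1K] y(1) by (simp add: R_def dist_commute)
  have "y \<noteq> z" using y z by auto
  then have "0 < R" by (simp add: R_def)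
  moreover have "cball y (2 * R) \<subseteq> \<Omega>"
  proof
    fix x assume "x \<in> cball y (2 * R)"
    then have "dist z1 x \<le> 3 * \<rho>" using dist_triangle[of z1 x y] y(1) R by auto
    then show "x \<in> \<Omega>" using sub by auto
  qed
  moreover have "0 < u x" if "x \<in> ball y R" for x
  proof -
    have "dist z1 x \<le> 3 * \<rho>" using dist_triangle[of z1 x y] y(1) R that \<rho> by auto
    then have "x \<in> \<Omega>" "x \<in> cball z1 (3 * \<rho>)" using sub by auto
    moreover have "u x \<noteq> 0" using z(2)[of x] that \<open>x \<in> cball z1 (3 * \<rho>)\<close> by (force simp: R_def)
    ultimately show ?thesis using nn[of x] by simp
  qed
  moreover have "u z = 0" using z(1) by simp
  ultimately show ?thesis by (intro that[OF _ _ R_def[symmetric]])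
qed

text \<open>Where \<open>u\<close> is constant, a minimum of u - \<phi> is a maximum of \<phi>,
  forcing a zero gradient. This excludes the constant case in the definition of a supersolution, so
  the test function inequality becomes available.\<close>

lemma not_const_near_of_touching:
  fixes u \<phi> :: "real^'n \<Rightarrow> real"
  assumes "local_min_at \<Omega> (\<lambda>x. u x - \<phi> x) x" "\<phi> differentiable (at x)" "grad \<phi> x \<noteq> 0"
  shows "\<not> const_near \<Omega> u x \<epsilon> K"
proof
  assume c: "const_near \<Omega> u x \<epsilon> K"
  obtain r where r: "0 < r" "\<And>y. y \<in> \<Omega> \<inter> ball x r \<Longrightarrow> u x - \<phi> x \<le> u y - \<phi> y"
    using assms(1) unfolding local_min_at_def by blast
  have "(\<phi> has_derivative frechet_derivative \<phi> (at x)) (at x)"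
    using assms(2) by (simp add: frechet_derivative_works)
  moreover have "\<phi> y \<le> \<phi> x" if "y \<in> ball x (min r \<epsilon>)" for y
    using that r(2)[of y] c by (auto simp: const_near_def subset_iff)
  ultimately have "frechet_derivative \<phi> (at x) = (\<lambda>v. 0)"
    using differential_zero_maxmin[of x "ball x (min r \<epsilon>)" \<phi>] r(1) c
    by (auto simp: const_near_def)
  then show False using assms(3) by (simp add: grad_def vec_eq_iff)
qed

text \<open>\<open>F_zero\<close> is assumed besides (F1) and (F2), which do not imply it: for
  \<gamma> = 0 and lam = Lam = 1 both hold for F = tr M - 1. On (-1,1) with b = 0 and lam0 = 1, the
  function equal to 0 for x \<le> 0 and to cosh x - 1 for x > 0 is then a solution violating the
  conclusion.\<close>

theorem theorem1p3:
  fixes \<Omega> :: "(real^'n) set"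
    and F :: "real^'n \<Rightarrow> real^'n \<Rightarrow> real^'n^'n \<Rightarrow> real"
    and b :: "real^'n \<Rightarrow> real^'n"
    and lam0 u :: "real^'n \<Rightarrow> real"
    and \<gamma> lam Lam :: real
  assumes gamma: "\<gamma> > -1"
    and ellipticity: "0 < lam" "lam \<le> Lam"
    and domain: "smooth_bounded_domain \<Omega>"
    and b_cont: "continuous_on (closure \<Omega>) b"
    and lam0_cont: "continuous_on (closure \<Omega>) lam0"
    and lam0_bounds: "\<exists>m M. 0 < m \<and> (\<forall>x\<in>closure \<Omega>. m \<le> lam0 x \<and> lam0 x \<le> M)"
    and F_cont: "continuous_on (\<Omega> \<times> (- {0}) \<times> Sym) (\<lambda>(x, p, M). F x p M)"
    and F1: "\<And>x p M P. x \<in> \<Omega> \<Longrightarrow> p \<noteq> 0 \<Longrightarrow> M \<in> Sym \<Longrightarrow> P \<in> Sym \<Longrightarrow> pos_semidef P \<Longrightarrow>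
        norm p powr \<gamma> * pucci_minus lam Lam P \<le> F x p (M + P) - F x p M \<and>
        F x p (M + P) - F x p M \<le> norm p powr \<gamma> * pucci_plus lam Lam P"
    and F2: "\<And>s x p M. s \<noteq> 0 \<Longrightarrow> x \<in> \<Omega> \<Longrightarrow> p \<noteq> 0 \<Longrightarrow> M \<in> Sym \<Longrightarrow>
        F x (s *\<^sub>R p) M = \<bar>s\<bar> powr \<gamma> * F x p M"
    and F_zero: "\<And>x p. x \<in> \<Omega> \<Longrightarrow> p \<noteq> 0 \<Longrightarrow> F x p 0 = 0"
    and u_nonneg: "\<forall>x\<in>\<Omega>. 0 \<le> u x"
    and u_bounded: "bounded (u ` \<Omega>)"
    and u_sol: "viscosity_solution \<Omega>
        (\<lambda>x p M. F x p M + norm p powr \<gamma> * (b x \<bullet> p))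
        (\<lambda>x s. lam0 x * s powr (\<gamma> + 1) * indicator {t. t > 0} s) u"
  shows "(\<forall>x\<in>\<Omega>. u x > 0) \<or> (\<forall>x\<in>\<Omega>. u x = 0)"
proof (rule ccontr)
  assume "\<not> ?thesis"
  then have "\<exists>x\<in>\<Omega>. u x = 0" "\<exists>x\<in>\<Omega>. u x > 0"
    using u_nonneg by force+
  moreover have dom: "open \<Omega>" "connected \<Omega>" "bounded \<Omega>"
    using domain by (auto simp: smooth_bounded_domain_def)
  moreover have cont: "continuous_on \<Omega> u"
    using u_sol by (simp add: viscosity_solution_def viscosity_supersolution_def)
  ultimately obtain y z R where R: "0 < R" "cball y (2 * R) \<subseteq> \<Omega>"
    and z: "dist y z = R" "u z = 0" and pos: "\<And>x. x \<in> ball y R \<Longrightarrow> 0 < u x"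
    using touching_ball[of \<Omega> u] u_nonneg by metis

  \<comment> \<open>Coefficient bounds and decay rate of the barrier\<close>
  obtain m0 M where m0: "0 < m0" "\<And>x. x \<in> closure \<Omega> \<Longrightarrow> m0 \<le> lam0 x \<and> lam0 x \<le> M"
    using lam0_bounds by blast
  have "bounded (b ` closure \<Omega>)"
    using dom b_cont by (intro compact_imp_bounded compact_continuous_image) auto
  then obtain \<beta> where \<beta>: "\<And>x. x \<in> closure \<Omega> \<Longrightarrow> norm (b x) \<le> \<beta>"
    unfolding bounded_iff by blast
  have zc: "z \<in> closure \<Omega>" using R z closure_subset[of \<Omega>] by (auto simp: subset_iff)
  have "0 \<le> M" "0 \<le> \<beta>" using m0(1) m0(2)[OF zc] order_trans[OF norm_ge_zero \<beta>[OF zc]] by auto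
  define T where "T = \<beta> + Lam * CARD('n) / (R / 2) + M"
  have "0 \<le> T" using \<open>0 \<le> M\<close> \<open>0 \<le> \<beta>\<close> ellipticity R by (simp add: T_def)
  \<comment> \<open>Chosen so that lam a R = lam + T + 1 > T and a R \<ge> 1. Outside radius R/2 one
    has 2a|x - y| \<ge> a R, so both size conditions of the barrier lemma hold there, and
    \<open>a\<close> does not depend on the height \<open>c\<close>.\<close>
  define a where "a = (1 + (T + 1) / lam) / R"
  have "0 < a" using \<open>0 \<le> T\<close> ellipticity R by (simp add: a_def add_pos_pos)
  have aR: "a * R = 1 + (T + 1) / lam" using R(1) by (simp add: a_def)
  then have "lam * (a * R) = lam + T + 1" using ellipticity(1) by (simp add: field_simps)
  then have a: "1 \<le> a * R" "T < lam * (a * R)"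
    using aR \<open>0 \<le> T\<close> ellipticity(1) by simp_all

  \<comment> \<open>Height and shift of the barrier\<close>
  have "sphere y (R / 2) \<subseteq> ball y R" using R by (auto simp: subset_iff)
  moreover have "ball y R \<subseteq> \<Omega>" using R by (auto simp: subset_iff)
  ultimately have S: "sphere y (R / 2) \<subseteq> \<Omega>" "\<And>x. x \<in> sphere y (R / 2) \<Longrightarrow> 0 < u x"
    using pos by auto
  obtain x1 where x1: "x1 \<in> sphere y (R / 2)" "\<And>x. x \<in> sphere y (R / 2) \<Longrightarrow> u x1 \<le> u x"
    using continuous_attains_inf[of "sphere y (R / 2)" u] continuous_on_subset[OF cont S(1)] R
    by auto
  define c where "c = u x1"
  have "0 < c" using S(2) x1(1) by (simp add: c_def)
  \<comment> \<open>This shift makes the barrier vanish exactly at distance R from \<open>y\<close>,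
    hence at \<open>z\<close>.\<close>
  define d where "d = c * exp (- a * R\<^sup>2)"
  have "0 < d" using \<open>0 < c\<close> by (simp add: d_def)
  define \<phi> where "\<phi> = hopf a c d y"
  have phi: "\<phi> x = c * exp (- a * (dist y x)\<^sup>2) - d" for x
    by (simp add: \<phi>_def hopf_def dist_norm power2_norm_eq_inner[symmetric] norm_minus_commute)

  \<comment> \<open>An interior minimum of u - \<phi>\<close>
  define A where "A = cball y (2 * R) - ball y (R / 2)"
  have "A \<subseteq> \<Omega>" using R by (auto simp: A_def)
  have "compact A" by (simp add: A_def compact_diff)
  have "z \<in> A" using R z by (auto simp: A_def)
  have "continuous_on A (\<lambda>x. u x - \<phi> x)"
    unfolding \<phi>_def using continuous_on_subset[OF cont \<open>A \<subseteq> \<Omega>\<close>]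
    by (intro continuous_on_diff continuous_on_hopf)
  then obtain x0 where x0: "x0 \<in> A" "\<And>x. x \<in> A \<Longrightarrow> u x0 - \<phi> x0 \<le> u x - \<phi> x"
    using continuous_attains_inf[OF \<open>compact A\<close>] \<open>z \<in> A\<close> by blast
  have "\<phi> z = 0" by (simp add: phi z d_def)
  then have le: "u x0 \<le> \<phi> x0" using x0(2)[OF \<open>z \<in> A\<close>] z by simp
  have "x0 \<in> \<Omega>" using x0(1) \<open>A \<subseteq> \<Omega>\<close> by blast
  then have u0: "0 \<le> u x0" using u_nonneg by blast
  \<comment> \<open>Beyond distance R the barrier is negative, but \<phi> \<ge> u \<ge> 0 at
    \<open>x0\<close>; this keeps \<open>x0\<close> off the outer sphere.\<close>
  have "c * exp (- a * R\<^sup>2) \<le> c * exp (- a * (dist y x0)\<^sup>2)"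
    using u0 le by (simp add: phi d_def)
  then have "exp (- a * R\<^sup>2) \<le> exp (- a * (dist y x0)\<^sup>2)"
    using \<open>0 < c\<close> by simp
  then have "(dist y x0)\<^sup>2 \<le> R\<^sup>2" using \<open>0 < a\<close> by simp
  then have up: "dist y x0 \<le> R" using R(1) by (simp add: power2_le_iff_abs_le)
  \<comment> \<open>On the inner sphere u \<ge> c, whereas \<phi> \<le> c - d < c, contradicting u
    \<le> \<phi> at \<open>x0\<close>.\<close>
  have "R / 2 \<noteq> dist y x0"
  proof
    assume "R / 2 = dist y x0"
    then have "c \<le> u x0" using x1(2)[of x0] by (simp add: c_def)
    moreover have "exp (- a * (dist y x0)\<^sup>2) \<le> 1" using \<open>0 < a\<close> by simp
    then have "\<phi> x0 \<le> c * 1 - d"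
      unfolding phi using \<open>0 < c\<close> by (intro diff_right_mono mult_left_mono) auto
    ultimately show False using le \<open>0 < d\<close> by simp
  qed
  then have low: "R / 2 < dist y x0" using x0(1) by (simp add: A_def)

  have "x0 \<in> ball y (2 * R) - cball y (R / 2)" using up low R by auto
  moreover have "open (ball y (2 * R) - cball y (R / 2))" by (simp add: open_Diff)
  ultimately obtain r where "0 < r" "ball x0 r \<subseteq> ball y (2 * R) - cball y (R / 2)"
    unfolding open_contains_ball by blast
  then have loc: "local_min_at \<Omega> (\<lambda>x. u x - \<phi> x) x0"
    unfolding local_min_at_def using x0(2) by (intro exI[of _ r]) (force simp: A_def)

  \<comment> \<open>Contradiction at the minimum point\<close>
  have E0: "0 < hopf a c 0 y x0" using \<open>0 < c\<close> by (simp add: hopf_def)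
  have "x0 \<noteq> y" using low R by auto
  then have g: "grad \<phi> x0 \<noteq> 0" using E0 \<open>0 < a\<close> by (simp add: \<phi>_def grad_hopf)
  have "\<phi> differentiable (at x0)"
    unfolding \<phi>_def using hopf_has_derivative differentiableI by blast
  then have "\<nexists>\<epsilon> K. const_near \<Omega> u x0 \<epsilon> K"
    using not_const_near_of_touching[OF loc _ g] by blast
  moreover have "Ck_on 2 \<phi> \<Omega>" by (simp add: \<phi>_def Ck_on_hopf)
  ultimately have "F x0 (grad \<phi> x0) (hessian \<phi> x0) +
      norm (grad \<phi> x0) powr \<gamma> * (b x0 \<bullet> grad \<phi> x0)
      \<le> lam0 x0 * u x0 powr (\<gamma> + 1) * indicator {t. t > 0} (u x0)"
    using u_sol \<open>x0 \<in> \<Omega>\<close> loc g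
    by (simp add: viscosity_solution_def viscosity_supersolution_def)
  also have "\<dots> \<le> M * hopf a c 0 y x0 powr (\<gamma> + 1)"
  proof -
    \<comment> \<open>Dropping the shift only enlarges \<phi>, and the bare exponential is the
      quantity with the scaling of the barrier lemma.\<close>
    have "u x0 \<le> hopf a c 0 y x0"
      using le \<open>0 < d\<close> by (simp add: \<phi>_def hopf_def)
    then have "u x0 powr (\<gamma> + 1) \<le> hopf a c 0 y x0 powr (\<gamma> + 1)"
      using gamma u0 by (intro powr_mono2) auto
    moreover have "lam0 x0 \<le> M" using m0(2) \<open>x0 \<in> \<Omega>\<close> closure_subset by blast
    ultimately have "lam0 x0 * u x0 powr (\<gamma> + 1) \<le> M * hopf a c 0 y x0 powr (\<gamma> + 1)"
      using \<open>0 \<le> M\<close> by (intro mult_mono) auto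
    then show ?thesis using \<open>0 \<le> M\<close> by (simp add: indicator_def)
  qed
  also have "\<dots> < F x0 (grad \<phi> x0) (hessian \<phi> x0) +
      norm (grad \<phi> x0) powr \<gamma> * (b x0 \<bullet> grad \<phi> x0)"
  proof -
    have v: "R / 2 \<le> norm (x0 - y)" using low by (simp add: dist_norm norm_minus_commute)
    then have aR: "a * R \<le> 2 * a * norm (x0 - y)" using \<open>0 < a\<close> by simp
    then have "1 \<le> 2 * a * norm (x0 - y)" using a(1) by linarith
    moreover have "lam * (a * R) \<le> lam * (2 * a * norm (x0 - y))"
      using aR ellipticity by (intro mult_left_mono) auto
    then have "T < lam * (2 * a * norm (x0 - y))" using a(2) by linarith
    moreover have "norm (b x0) \<le> \<beta>" using \<beta> \<open>x0 \<in> \<Omega>\<close> closure_subset by blast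
    moreover note F1[OF \<open>x0 \<in> \<Omega>\<close> g] F_zero[OF \<open>x0 \<in> \<Omega>\<close> g]
    ultimately show ?thesis
      unfolding \<phi>_def T_def using gamma \<open>0 < a\<close> \<open>0 < c\<close> R(1) ellipticity v \<open>0 \<le> M\<close>
      by (intro hopf_strict_subsolution[where r = "R / 2" and lam = lam and Lam = Lam and \<beta> = \<beta>])
        (assumption | simp)+
  qed
  finally show False by simp
qed

end
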